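(* Let $u^0\in\mathbb{M}_h$ satisfy $\|u^0\|_\infty\le\beta$, and let $(u^n)_{0\le n\le N_t}$ be generated from $u^0$ by the ESS1 method with time step $\tau$. If $\kappa\ge\|f'\|_{C[-\beta,\beta]}$ and $0<\tau\le\frac{h^2}{2\varepsilon^2}$, then $$\|u^n\|_\infty\le\beta\qquad\text{for all }0\le n\le N_t.$$
   Context: Problem: the two-dimensional Allen-Cahn equation $u_t=\varepsilon^2\Delta u+f(u)$ on $\Omega=(0,2\pi)^2$ with periodic boundary conditions, $t\in(0,T]$, $T>0$, $\varepsilon>0$. Assumptions on $f$: $\beta>0$ is a constant, $f$ is a real-valued function on an interval containing $[-\beta,\beta]$, continuously differentiable on $[-\beta,\beta]$, with $f(\beta)\le 0\le f(-\beta)$. Write $\|f'\|_{C[-\beta,\beta]}=\max_{\xi\in[-\beta,\beta]}|f'(\xi)|$. Grid: $M$ is a positive integer, $h=2\pi/M$. $\mathbb{M}_h$ is the space of real grid functions $v=(v_{ij})_{0\le i,j\le M-1}$, identified with $M\times M$ real matrices, and $\|v\|_\infty=\max_{i,j}|v_{ij}|$. $\tau>0$ is the time step, $t_n=n\tau$, $N_t=\lfloor T/\tau\rfloor$. Operators: $D_a$ is the $M\times M$ matrix (indices $0,\dots,M-1$) equal to $h^{-2}$ times the matrix with $-1$ on the diagonal, $1$ at positions $(i,i+1)$ for $0\le i\le M-2$, $1$ at position $(0,M-1)$, and zeros elsewhere (contributions at coinciding positions are added when $M\le 2$). $D_b=D_a^{\mathrm T}$. For $v\in\mathbb{M}_h$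 set $\varDelta_a v=D_av+vD_a^{\mathrm T}$ and $\varDelta_b v=D_bv+vD_b^{\mathrm T}$. ESS1 method with stabilization parameter $\kappa$: $f$ acts entrywise, and $u^{n+1}$ is determined from $u^n$ by $$\frac{u^{n+1}-u^n}{\tau}=\varepsilon^2(\varDelta_au^n+\varDelta_bu^{n+1})+f(u^n)-\kappa(u^{n+1}-u^n).$$ *)

theory Defs
  imports Complex_Main "Jordan_Normal_Form.Matrix"
begin

text \<open>Grid functions with \<open>M\<close> points per direction are the elements of \<open>carrier_mat M M\<close>.\<close>

definition mesh :: "nat \<Rightarrow> real" where
  "mesh M = 2 * pi / real M"

definition sup_norm :: "real mat \<Rightarrow> real" where
  "sup_norm v = Max {\<bar>v $$ (i, j)\<bar> | i j. i < dim_row v \<and> j < dim_col v}"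

text \<open>The entries are added rather than given by cases, so that coinciding positions
  accumulate: \<open>(0, M - 1)\<close> is \<open>(0, 0)\<close> for \<open>M = 1\<close> and \<open>(0, 1)\<close> for \<open>M = 2\<close>.
  The corner entry lies above the diagonal, so for \<open>M \<ge> 2\<close> \<open>D_a M\<close> is upper triangular and not a
  circulant; only \<open>D_a M + D_b M\<close> is the periodic second difference matrix.\<close>

definition D_a :: "nat \<Rightarrow> real mat" where
  "D_a M = (1 / (mesh M)\<^sup>2) \<cdot>\<^sub>m mat M M (\<lambda>(i, j).
     (if i = j then - 1 else 0) + (if j = i + 1 then 1 else 0)
     + (if i = 0 \<and> j = M - 1 then 1 else 0))"

definition D_b :: "nat \<Rightarrow> real mat" where
  "D_b M = transpose_mat (D_a M)"

definition Delta_a :: "nat \<Rightarrow> real mat \<Rightarrow> real mat" where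
  "Delta_a M v = D_a M * v + v * transpose_mat (D_a M)"

definition Delta_b :: "nat \<Rightarrow> real mat \<Rightarrow> real mat" where
  "Delta_b M v = D_b M * v + v * transpose_mat (D_b M)"

definition ESS1_step ::
    "nat \<Rightarrow> real \<Rightarrow> (real \<Rightarrow> real) \<Rightarrow> real \<Rightarrow> real \<Rightarrow> real mat \<Rightarrow> real mat \<Rightarrow> bool" where
  "ESS1_step M \<epsilon> f \<kappa> \<tau> v w \<longleftrightarrow>
     (1 / \<tau>) \<cdot>\<^sub>m (w - v) =
       \<epsilon>\<^sup>2 \<cdot>\<^sub>m (Delta_a M v + Delta_b M w) + map_mat f v - \<kappa> \<cdot>\<^sub>m (w - v)"

end

theory Submission imports Defs begin

text \<open>
  Written entrywise, with \<open>a = \<epsilon>\<^sup>2 / h\<^sup>2\<close>, a step from \<open>v\<close> to \<open>w\<close> reads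
  \<open>(1/\<tau> + \<kappa> + 2a) w\<^sub>i\<^sub>j = (1/\<tau> - 2a) v\<^sub>i\<^sub>j + (\<kappa> v\<^sub>i\<^sub>j + f (v\<^sub>i\<^sub>j)) + a S\<close>,
  where \<open>S\<close> adds up the four periodic neighbours of \<open>(i, j)\<close>, each of them taken from either \<open>v\<close> or \<open>w\<close>.
  In one direction the neighbours of \<open>i\<close> are its cyclic predecessor and successor, and for
  \<open>M \<ge> 2\<close> a neighbour enters with its new value exactly when its index is smaller than \<open>i\<close>, because
  \<open>D_a\<close> is upper triangular with its wrap-around entry above the diagonal. The first
  and last rows of \<open>D_a\<close> and \<open>D_b\<close> alone therefore do not sum to zero,
  but the weights in the displayed identity always add up:
  \<open>(1/\<tau> - 2a) + \<kappa> + 4a = 1/\<tau> + \<kappa> + 2a\<close>.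

  The time step restriction makes \<open>1/\<tau> - 2a\<close> nonnegative, and the stabilization makes
  \<open>\<xi> \<mapsto> \<kappa> \<xi> + f \<xi>\<close> monotone, so that the sign conditions on \<open>f\<close> at the end points bound it by \<open>\<kappa> \<beta>\<close>
  (\<open>stabilized_reaction_bound\<close>). Since for \<open>M \<ge> 2\<close> new values are only needed at smaller indices, the bound
  \<open>\<bar>w\<^sub>i\<^sub>j\<bar> \<le> \<beta>\<close> follows by induction on \<open>i + j\<close> (\<open>ESS1_step_bound\<close>), and the theorem by induction on
  time. For \<open>M = 1\<close> the point is its own neighbour, and \<open>w\<close> occurs on both sides with the weights
  \<open>1/\<tau> + \<kappa> + 2a\<close> and \<open>2a\<close>; the difference is positive, so the same estimate applies.

  A maximum principle at a point where \<open>\<bar>w\<bar>\<close> is largest would not suffice: at the corner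
  \<open>(M - 1, M - 1)\<close> all four neighbours are new when \<open>M \<ge> 2\<close>, and for \<open>\<kappa> = 0\<close>, \<open>1/\<tau> = 2a\<close> no weight is
  left on old values.
\<close>

section \<open>Entries of the one-sided differences\<close>

text \<open>What \<open>D_a\<close> (old values) and \<open>D_b\<close> (new values) contribute besides the diagonal
  \<open>- 1\<close>, up to the factor \<open>1 / h\<^sup>2\<close>. For \<open>M \<ge> 2\<close> both neighbours of \<open>0\<close> are old and both neighbours of \<open>M - 1\<close> are
  new; \<open>M = 1\<close> gives one of each, with the point as its own neighbour.\<close>

definition old_neighbours :: "nat \<Rightarrow> nat \<Rightarrow> (nat \<Rightarrow> real) \<Rightarrow> real" where
  "old_neighbours M i g = (if i + 1 < M then g (i + 1) else 0) + (if i = 0 then g (M - 1) else 0)"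

definition new_neighbours :: "nat \<Rightarrow> nat \<Rightarrow> (nat \<Rightarrow> real) \<Rightarrow> real" where
  "new_neighbours M i g = (if 0 < i then g (i - 1) else 0) + (if i = M - 1 then g 0 else 0)"

lemma D_a_dim [simp]: "dim_row (D_a M) = M" "dim_col (D_a M) = M"
  by (simp_all add: D_a_def)

lemma D_b_dim [simp]: "dim_row (D_b M) = M" "dim_col (D_b M) = M"
  by (simp_all add: D_b_def)

lemma sum_D_a_row:
  assumes "i < M"
  shows "(\<Sum>k<M. D_a M $$ (i, k) * g k) = (old_neighbours M i g - g i) / (mesh M)\<^sup>2"
proof -
  have "(\<Sum>k<M. D_a M $$ (i, k) * g k) =
      (\<Sum>k<M. (1 / (mesh M)\<^sup>2) * ((if k = i then - g i else 0) + (if k = i + 1 then g (i + 1) else 0)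
        + (if k = M - 1 then (if i = 0 then g (M - 1) else 0) else 0)))"
    using assms by (intro sum.cong refl) (auto simp: D_a_def algebra_simps)
  also have "\<dots> = (1 / (mesh M)\<^sup>2) * (- g i + (if i + 1 < M then g (i + 1) else 0)
        + (if i = 0 then g (M - 1) else 0))"
    unfolding sum_distrib_left [symmetric] sum.distrib using assms by (simp add: sum.delta)
  finally show ?thesis
    by (simp add: old_neighbours_def)
qed

lemma sum_D_b_row:
  assumes "i < M"
  shows "(\<Sum>k<M. D_b M $$ (i, k) * g k) = (new_neighbours M i g - g i) / (mesh M)\<^sup>2"
proof -
  have "(\<Sum>k<M. D_b M $$ (i, k) * g k) =
      (\<Sum>k<M. (1 / (mesh M)\<^sup>2) * ((if k = i then - g i else 0)
        + (if k = i - 1 then (if 0 < i then g (i - 1) else 0) else 0)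
        + (if k = 0 then (if i = M - 1 then g 0 else 0) else 0)))"
    using assms by (intro sum.cong refl) (auto simp: D_b_def D_a_def algebra_simps)
  also have "\<dots> = (1 / (mesh M)\<^sup>2) * (- g i + (if 0 < i then g (i - 1) else 0)
        + (if i = M - 1 then g 0 else 0))"
    unfolding sum_distrib_left [symmetric] sum.distrib using assms by (simp add: sum.delta)
  finally show ?thesis
    by (simp add: new_neighbours_def)
qed

lemma two_sided_mult_entry:
  fixes A v :: "real mat"
  assumes "A \<in> carrier_mat M M" "v \<in> carrier_mat M M" "i < M" "j < M"
  shows "(A * v + v * transpose_mat A) $$ (i, j) =
    (\<Sum>k<M. A $$ (i, k) * v $$ (k, j)) + (\<Sum>k<M. A $$ (j, k) * v $$ (i, k))"
  using assms by (simp add: scalar_prod_def lessThan_atLeast0 mult.commute)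

lemma Delta_a_entry:
  assumes "v \<in> carrier_mat M M" "i < M" "j < M"
  shows "Delta_a M v $$ (i, j) =
    (old_neighbours M i (\<lambda>k. v $$ (k, j)) + old_neighbours M j (\<lambda>k. v $$ (i, k))
      - 2 * v $$ (i, j)) / (mesh M)\<^sup>2"
  unfolding Delta_a_def
  using assms by (subst two_sided_mult_entry) 
    (auto simp: sum_D_a_row diff_divide_distrib add_divide_distrib)

lemma Delta_b_entry:
  assumes "v \<in> carrier_mat M M" "i < M" "j < M"
  shows "Delta_b M v $$ (i, j) =
    (new_neighbours M i (\<lambda>k. v $$ (k, j)) + new_neighbours M j (\<lambda>k. v $$ (i, k))
      - 2 * v $$ (i, j)) / (mesh M)\<^sup>2"
  unfolding Delta_b_def
  using assms by (subst two_sided_mult_entry)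
    (auto simp: sum_D_b_row diff_divide_distrib add_divide_distrib)

text \<open>The explicit diagonal stays on the right and the implicit one moves to the left, so
  the form of the scheme below shows all weights with a definite sign.\<close>

lemma ESS1_step_entry:
  assumes step: "ESS1_step M \<epsilon> f \<kappa> \<tau> v w"
    and v: "v \<in> carrier_mat M M" and w: "w \<in> carrier_mat M M" and ij: "i < M" "j < M"
  defines "a \<equiv> \<epsilon>\<^sup>2 / (mesh M)\<^sup>2"
  shows "(1 / \<tau> + \<kappa> + 2 * a) * w $$ (i, j) =
    (1 / \<tau> - 2 * a) * v $$ (i, j) + (\<kappa> * v $$ (i, j) + f (v $$ (i, j)))
    + a * ((old_neighbours M i (\<lambda>k. v $$ (k, j)) + new_neighbours M i (\<lambda>k. w $$ (k, j)))
         + (old_neighbours M j (\<lambda>k. v $$ (i, k)) + new_neighbours M j (\<lambda>k. w $$ (i, k))))"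
proof -
  have dims: "Delta_a M v \<in> carrier_mat M M" "Delta_b M w \<in> carrier_mat M M"
    using v w by (auto simp: Delta_a_def Delta_b_def)
  have "((1 / \<tau>) \<cdot>\<^sub>m (w - v)) $$ (i, j) =
      (\<epsilon>\<^sup>2 \<cdot>\<^sub>m (Delta_a M v + Delta_b M w) + map_mat f v - \<kappa> \<cdot>\<^sub>m (w - v)) $$ (i, j)"
    using step by (simp only: ESS1_step_def)
  then have "(1 / \<tau>) * (w $$ (i, j) - v $$ (i, j)) =
      \<epsilon>\<^sup>2 * (Delta_a M v $$ (i, j) + Delta_b M w $$ (i, j)) + f (v $$ (i, j))
      - \<kappa> * (w $$ (i, j) - v $$ (i, j))"
    using v w ij dims by auto
  then show ?thesis
    unfolding Delta_a_entry [OF v ij] Delta_b_entry [OF w ij] a_def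
    by (simp add: algebra_simps add_divide_distrib diff_divide_distrib)
qed

section \<open>Bounds for the reaction and the neighbour sums\<close>

lemma abs_le_SUP_Icc:
  fixes g :: "real \<Rightarrow> real"
  assumes cont: "continuous_on {a..b} g" and x: "x \<in> {a..b}"
  shows "\<bar>g x\<bar> \<le> (SUP \<xi>\<in>{a..b}. \<bar>g \<xi>\<bar>)"
proof (rule cSUP_upper [OF x])
  have "continuous_on {a..b} (\<lambda>x. \<bar>g x\<bar>)"
    using cont by (intro continuous_intros)
  then obtain m where "\<And>y. y \<in> {a..b} \<Longrightarrow> \<bar>g y\<bar> \<le> \<bar>g m\<bar>"
    using continuous_attains_sup [of "{a..b}" "\<lambda>x. \<bar>g x\<bar>"] x by fastforce
  then show "bdd_above ((\<lambda>\<xi>. \<bar>g \<xi>\<bar>) ` {a..b})"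
    by (intro bdd_aboveI2)
qed

text \<open>As \<open>\<kappa>\<close> dominates \<open>\<bar>f'\<bar>\<close>, the function \<open>\<xi> \<mapsto> \<kappa> \<xi> + f \<xi>\<close> is nondecreasing, so its
  values lie between those at the end points, where the signs of \<open>f\<close> are known.\<close>

lemma stabilized_reaction_bound:
  fixes f f' :: "real \<Rightarrow> real"
  assumes deriv: "\<And>x. x \<in> {-\<beta>..\<beta>} \<Longrightarrow> (f has_real_derivative f' x) (at x within {-\<beta>..\<beta>})"
    and bound: "\<And>x. x \<in> {-\<beta>..\<beta>} \<Longrightarrow> \<bar>f' x\<bar> \<le> \<kappa>"
    and "f \<beta> \<le> 0" and "0 \<le> f (-\<beta>)"
    and x: "\<bar>x\<bar> \<le> \<beta>"
  shows "\<bar>\<kappa> * x + f x\<bar> \<le> \<kappa> * \<beta>"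
proof -
  let ?g = "\<lambda>x. \<kappa> * x + f x"
  have cont: "continuous_on {-\<beta>..\<beta>} f"
    using deriv by (meson DERIV_continuous_on)
  have mono: "?g y \<le> ?g z" if "-\<beta> \<le> y" "y \<le> z" "z \<le> \<beta>" for y z
  proof (rule DERIV_nonneg_imp_increasing_open [OF \<open>y \<le> z\<close>])
    fix t assume t: "y < t" "t < z"
    then have "(f has_real_derivative f' t) (at t)"
      using deriv [of t] that at_within_Icc_at [of "-\<beta>" t \<beta>] by auto
    then have "(?g has_real_derivative \<kappa> + f' t) (at t)"
      by (auto intro!: derivative_eq_intros)
    moreover have "0 \<le> \<kappa> + f' t"
      using bound [of t] t that by auto
    ultimately show "\<exists>d. (?g has_real_derivative d) (at t) \<and> 0 \<le> d"
      by blast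
  next
    show "continuous_on {y..z} ?g"
      using that by (intro continuous_intros continuous_on_subset [OF cont]) auto
  qed
  show ?thesis
    using mono [of x \<beta>] mono [of "-\<beta>" x] x assms(3,4) by (simp add: abs_le_iff)
qed

text \<open>Old and new neighbour sums together contain two terms. If the old values and the new values at
  smaller indices are bounded by \<open>\<beta>\<close>, the only other possible term is \<open>w i\<close> itself, and it occurs
  at most once, namely as the cyclic successor of the single index when \<open>M = 1\<close>.\<close>

lemma neighbours_bound:
  assumes "i < M" and v: "\<And>k. k < M \<Longrightarrow> \<bar>v k\<bar> \<le> \<beta>" and w: "\<And>k. k < i \<Longrightarrow> \<bar>w k\<bar> \<le> \<beta>"
  shows "\<bar>old_neighbours M i v + new_neighbours M i w\<bar> \<le> \<beta> + max \<beta> \<bar>w i\<bar>"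
proof -
  have pred: "\<bar>if i = 0 then v (M - 1) else w (i - 1)\<bar> \<le> \<beta>"
    using assms by auto
  have succ: "\<bar>if i + 1 < M then v (i + 1) else w 0\<bar> \<le> max \<beta> \<bar>w i\<bar>"
    using v [of "i + 1"] w [of 0] by (cases "i = 0") auto
  have "old_neighbours M i v + new_neighbours M i w =
      (if i = 0 then v (M - 1) else w (i - 1)) + (if i + 1 < M then v (i + 1) else w 0)"
    using \<open>i < M\<close> by (auto simp: old_neighbours_def new_neighbours_def)
  then show ?thesis
    using pred succ by linarith
qed

section \<open>Propagation of the bound\<close>

lemma ESS1_step_bound:
  assumes step: "ESS1_step M \<epsilon> f \<kappa> \<tau> v w"
    and v: "v \<in> carrier_mat M M" and w: "w \<in> carrier_mat M M"
    and "0 < \<tau>" and "0 \<le> \<kappa>" and cfl: "2 * (\<epsilon>\<^sup>2 / (mesh M)\<^sup>2) \<le> 1 / \<tau>"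
    and react: "\<And>x. \<bar>x\<bar> \<le> \<beta> \<Longrightarrow> \<bar>\<kappa> * x + f x\<bar> \<le> \<kappa> * \<beta>"
    and vb: "\<And>i j. i < M \<Longrightarrow> j < M \<Longrightarrow> \<bar>v $$ (i, j)\<bar> \<le> \<beta>"
    and "i < M" and "j < M"
  shows "\<bar>w $$ (i, j)\<bar> \<le> \<beta>"
  using \<open>i < M\<close> \<open>j < M\<close>
proof (induction "i + j" arbitrary: i j rule: less_induct)
  case less
  define a where "a = \<epsilon>\<^sup>2 / (mesh M)\<^sup>2"
  define S\<^sub>1 where
    "S\<^sub>1 = old_neighbours M i (\<lambda>k. v $$ (k, j)) + new_neighbours M i (\<lambda>k. w $$ (k, j))"
  define S\<^sub>2 where
    "S\<^sub>2 = old_neighbours M j (\<lambda>k. v $$ (i, k)) + new_neighbours M j (\<lambda>k. w $$ (i, k))"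
  let ?V = "v $$ (i, j)" and ?W = "w $$ (i, j)"
  have S1: "\<bar>S\<^sub>1\<bar> \<le> \<beta> + max \<beta> \<bar>?W\<bar>"
    unfolding S\<^sub>1_def using less vb by (intro neighbours_bound) auto
  have S2: "\<bar>S\<^sub>2\<bar> \<le> \<beta> + max \<beta> \<bar>?W\<bar>"
    unfolding S\<^sub>2_def using less vb by (intro neighbours_bound) auto
  have a: "0 \<le> a" "0 \<le> 1 / \<tau> - 2 * a"
    using cfl by (auto simp: a_def)
  show ?case
    \<comment> \<open>Assuming \<open>\<beta> < \<bar>?W\<bar>\<close> turns both maxima into \<open>\<bar>?W\<bar>\<close>. Moving these terms to the left removes
        exactly \<open>2 * a\<close> and leaves the weight \<open>1 / \<tau> + \<kappa> > 0\<close>, whatever \<open>a\<close> is.\<close>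
  proof (rule ccontr)
    assume "\<not> ?thesis"
    then have big: "\<beta> < \<bar>?W\<bar>"
      by simp
    have pos: "0 < 1 / \<tau> + \<kappa>"
      using \<open>0 < \<tau>\<close> \<open>0 \<le> \<kappa>\<close> by (simp add: add_pos_nonneg)
    have "(1 / \<tau> + \<kappa> + 2 * a) * \<bar>?W\<bar> = \<bar>(1 / \<tau> + \<kappa> + 2 * a) * ?W\<bar>"
      using pos a(1) by (simp add: abs_mult)
    also have "(1 / \<tau> + \<kappa> + 2 * a) * ?W =
        (1 / \<tau> - 2 * a) * ?V + (\<kappa> * ?V + f ?V) + a * (S\<^sub>1 + S\<^sub>2)"
      unfolding a_def S\<^sub>1_def S\<^sub>2_def by (rule ESS1_step_entry [OF step v w less.prems])
    also have "\<bar>\<dots>\<bar> \<le> (1 / \<tau> - 2 * a) * \<bar>?V\<bar> + \<bar>\<kappa> * ?V + f ?V\<bar> + a * \<bar>S\<^sub>1 + S\<^sub>2\<bar>"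
      using a abs_mult [of "1 / \<tau> - 2 * a" ?V] abs_mult [of a "S\<^sub>1 + S\<^sub>2"] by linarith
    also have "\<dots> \<le> (1 / \<tau> - 2 * a) * \<beta> + \<kappa> * \<beta> + a * (2 * \<beta> + 2 * \<bar>?W\<bar>)"
      using S1 S2 big a vb [OF less.prems]
      by (intro add_mono mult_left_mono react) auto
    finally have "(1 / \<tau> + \<kappa>) * \<bar>?W\<bar> \<le> (1 / \<tau> + \<kappa>) * \<beta>"
      by (simp add: algebra_simps)
    then show False
      using pos big by (simp add: mult_le_cancel_left)
  qed
qed

lemma sup_norm_le_iff:
  assumes "v \<in> carrier_mat M M" and "0 < M"
  shows "sup_norm v \<le> b \<longleftrightarrow> (\<forall>i<M. \<forall>j<M. \<bar>v $$ (i, j)\<bar> \<le> b)"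
proof -
  let ?A = "(\<lambda>(i, j). \<bar>v $$ (i, j)\<bar>) ` ({..<M} \<times> {..<M})"
  have "{\<bar>v $$ (i, j)\<bar> | i j. i < dim_row v \<and> j < dim_col v} = ?A"
    using assms by force
  then have "sup_norm v = Max ?A"
    by (simp only: sup_norm_def)
  moreover have "finite ?A"
    by simp
  moreover have "?A \<noteq> {}"
    unfolding image_is_empty Times_empty lessThan_empty_iff using \<open>0 < M\<close> by simp
  ultimately have "sup_norm v \<le> b \<longleftrightarrow> (\<forall>x\<in>?A. x \<le> b)"
    by (metis Max_le_iff)
  also have "\<dots> \<longleftrightarrow> (\<forall>i<M. \<forall>j<M. \<bar>v $$ (i, j)\<bar> \<le> b)"
    by auto
  finally show ?thesis .
qed

theorem theorem3p1:
  fixes f f' :: "real \<Rightarrow> real" and \<beta> \<epsilon> \<kappa> \<tau> T :: real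
    and M :: nat and u :: "nat \<Rightarrow> real mat"
  assumes "M > 0" and "\<epsilon> > 0" and "T > 0" and "\<beta> > 0"
    and "\<And>x. x \<in> {-\<beta>..\<beta>} \<Longrightarrow> (f has_real_derivative f' x) (at x within {-\<beta>..\<beta>})"
    and "continuous_on {-\<beta>..\<beta>} f'"
    and "f \<beta> \<le> 0" and "0 \<le> f (-\<beta>)"
    and "\<And>n. n \<le> nat \<lfloor>T / \<tau>\<rfloor> \<Longrightarrow> u n \<in> carrier_mat M M"
    and "sup_norm (u 0) \<le> \<beta>"
    and "\<And>n. n < nat \<lfloor>T / \<tau>\<rfloor> \<Longrightarrow> ESS1_step M \<epsilon> f \<kappa> \<tau> (u n) (u (Suc n))"
    and "\<kappa> \<ge> (SUP \<xi>\<in>{-\<beta>..\<beta>}. \<bar>f' \<xi>\<bar>)"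
    and "0 < \<tau>" and "\<tau> \<le> (mesh M)\<^sup>2 / (2 * \<epsilon>\<^sup>2)"
  shows "\<forall>n \<le> nat \<lfloor>T / \<tau>\<rfloor>. sup_norm (u n) \<le> \<beta>"
proof -
  have bound: "\<bar>f' x\<bar> \<le> \<kappa>" if "x \<in> {-\<beta>..\<beta>}" for x
    using abs_le_SUP_Icc [OF assms(6) that] assms(12) by linarith
  have react: "\<bar>\<kappa> * x + f x\<bar> \<le> \<kappa> * \<beta>" if "\<bar>x\<bar> \<le> \<beta>" for x
    by (rule stabilized_reaction_bound [OF assms(5) bound assms(7,8) that])
  have kappa: "0 \<le> \<kappa>"
    using bound [of 0] \<open>\<beta> > 0\<close> by auto
  have "0 < mesh M"
    using \<open>M > 0\<close> by (simp add: mesh_def)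
  then have cfl: "2 * (\<epsilon>\<^sup>2 / (mesh M)\<^sup>2) \<le> 1 / \<tau>"
    using \<open>\<epsilon> > 0\<close> assms(13,14) by (simp add: field_simps)
  have "sup_norm (u n) \<le> \<beta>" if "n \<le> nat \<lfloor>T / \<tau>\<rfloor>" for n
    using that
  proof (induction n)
    case 0
    show ?case by (rule assms(10))
  next
    case (Suc n)
    have carr: "u n \<in> carrier_mat M M" "u (Suc n) \<in> carrier_mat M M"
      using Suc.prems assms(9) by auto
    have step: "ESS1_step M \<epsilon> f \<kappa> \<tau> (u n) (u (Suc n))"
      using Suc.prems assms(11) by simp
    have "\<bar>u n $$ (i, j)\<bar> \<le> \<beta>" if "i < M" "j < M" for i j
      using Suc sup_norm_le_iff [OF carr(1) \<open>M > 0\<close>] that by auto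
    then have "\<bar>u (Suc n) $$ (i, j)\<bar> \<le> \<beta>" if "i < M" "j < M" for i j
      using ESS1_step_bound [OF step carr \<open>0 < \<tau>\<close> kappa cfl react] that by blast
    then show ?case
      using sup_norm_le_iff [OF carr(2) \<open>M > 0\<close>] by blast
  qed
  then show ?thesis
    by blast
qed

end
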